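(* Let $p\colon\mathbb{N}\to(0,1)$ and let $G=G(n,p)$. If $D$ is chosen uniformly at random among the $2^{e(G)}$ orientations of $G$, then asymptotically almost surely (with probability tending to $1$ as $n\to\infty$, over both the choice of $G$ and the choice of $D$) $D$ has a Seymour vertex.
   Context: $G(n,p)$ is the random graph with vertex set $\{1,\dots,n\}$ in which every pair of vertices appears as an edge independently and with probability $p=p(n)$; $e(G)$ is the number of edges of $G$. An orientation of a simple graph $G$ is a digraph obtained by assigning a direction to each edge of $G$. For a vertex $u$ of an oriented graph and $i\in\mathbb{N}$, $N^i(u)$ is the set of vertices $v$ for which a shortest directed path from $u$ to $v$ has precisely $i$ arcs. A Seymour vertex is a vertex $u$ with $|N^2(u)|\ge |N^1(u)|$. *)

theory Defs
  imports "HOL-Probability.Probability" "Graph_Theory.Pair_Digraph"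
begin

text \<open>
  A simple graph on a vertex set \<open>V\<close> is given by its set of edges, an edge being a
  two-element subset of \<open>V\<close>.
\<close>

definition complete_edges :: "'a set \<Rightarrow> 'a set set" where
  "complete_edges V = {e. e \<subseteq> V \<and> card e = 2}"

definition gnp :: "nat \<Rightarrow> real \<Rightarrow> nat set set pmf" where
  "gnp n p = map_pmf (\<lambda>f. {e \<in> complete_edges {1..n}. f e})
     (Pi_pmf (complete_edges {1..n}) False (\<lambda>_. bernoulli_pmf p))"

text \<open>
  In an orientation each edge \<open>{u, v}\<close> underlies exactly one arc, which is either
  \<open>(u, v)\<close> or \<open>(v, u)\<close>, and there are no other arcs.
\<close>

definition orientations :: "'a set \<Rightarrow> 'a set set \<Rightarrow> 'a pair_pre_digraph set" where
  "orientations V E =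
     {D. pverts D = V \<and> bij_betw (\<lambda>(u, v). {u, v}) (parcs D) E}"

definition random_orientation :: "nat \<Rightarrow> real \<Rightarrow> nat pair_pre_digraph pmf" where
  "random_orientation n p =
     bind_pmf (gnp n p) (\<lambda>E. pmf_of_set (orientations {1..n} E))"

definition nth_neighborhood :: "'a pair_pre_digraph \<Rightarrow> nat \<Rightarrow> 'a \<Rightarrow> 'a set" where
  "nth_neighborhood D i u =
     {v. \<exists>xs. pre_digraph.apath (with_proj D) u xs v \<and> length xs = i \<and>
              (\<forall>ys. pre_digraph.apath (with_proj D) u ys v \<longrightarrow> length xs \<le> length ys)}"

definition seymour_vertex :: "'a pair_pre_digraph \<Rightarrow> 'a \<Rightarrow> bool" where
  "seymour_vertex D u \<longleftrightarrow>
     u \<in> pverts D \<and> card (nth_neighborhood D 2 u) \<ge> card (nth_neighborhood D 1 u)"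

text \<open>
  The argument of \<^const>\<open>pmf_of_set\<close> above is finite and nonempty, by the following
  count.
\<close>

lemma card_orientations:
  assumes "finite V" and E: "E \<subseteq> complete_edges V"
  shows "card (orientations V E) = 2 ^ card E"
proof -
  define und :: "'a \<times> 'a \<Rightarrow> 'a set" where "und = (\<lambda>(u, v). {u, v})"
  define C where "C = PiE E (\<lambda>e. {a. und a = e})"
  define F where "F = (\<lambda>f. \<lparr>pverts = V, parcs = f ` E\<rparr> :: 'a pair_pre_digraph)"
  have fin: "finite E"
    using assms by (auto simp: complete_edges_def intro: finite_subset[of _ "Pow V"])
  have two: "card {a. und a = e} = 2" if "e \<in> E" for e
  proof -
    from that E have "card e = 2" by (auto simp: complete_edges_def)
    then obtain x y where xy: "e = {x, y}" "x \<noteq> y" by (auto simp: card_2_iff)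
    then have "{a. und a = e} = {(x, y), (y, x)}"
      by (auto simp: und_def doubleton_eq_iff)
    with xy show ?thesis by simp
  qed
  have und: "und (f e) = e" if "f \<in> C" "e \<in> E" for f e
    using that by (auto simp: C_def PiE_def Pi_def)
  have "bij_betw F C (orientations V E)"
  proof (rule bij_betwI')
    fix f g assume fg: "f \<in> C" "g \<in> C"
    show "(F f = F g) = (f = g)"
    proof
      assume "F f = F g"
      then have im: "f ` E = g ` E" by (simp add: F_def)
      have "f e = g e" if "e \<in> E" for e
      proof -
        from im that have "f e \<in> g ` E" by blast
        then obtain e' where "e' \<in> E" "f e = g e'" by blast
        with und[OF fg(1) that] und[OF fg(2), of e'] show ?thesis by simp
      qed
      with fg show "f = g" unfolding C_def by (intro PiE_ext)
    qed simp
  next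
    fix f assume f: "f \<in> C"
    have "bij_betw und (f ` E) E"
      by (rule bij_betw_byWitness[where f' = f]) (use und[OF f] in auto)
    then show "F f \<in> orientations V E"
      by (simp add: F_def orientations_def und_def)
  next
    fix D assume "D \<in> orientations V E"
    then have D: "pverts D = V" "bij_betw und (parcs D) E"
      by (auto simp: orientations_def und_def)
    define f where "f = restrict (inv_into (parcs D) und) E"
    have "f \<in> C"
      using D(2) by (auto simp: C_def f_def bij_betw_inv_into_right)
    moreover have "f ` E = parcs D"
      using bij_betw_inv_into[OF D(2)] by (simp add: f_def bij_betw_def)
    then have "F f = D" using D(1) by (simp add: F_def)
    ultimately show "\<exists>f\<in>C. D = F f" by blast
  qed
  then have "card (orientations V E) = card C" by (simp add: bij_betw_same_card)
  also have "\<dots> = 2 ^ card E" using fin two by (simp add: C_def card_PiE)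
  finally show ?thesis .
qed

end

theory Submission
  imports Defs
begin

text \<open>
  Write \<open>q = p / 2\<close>, so that each arc is present with probability \<open>q\<close>. Failure is bounded
  uniformly in \<open>q\<close> by one of three arguments. If \<open>(n - 1) q \<le> ln n / 4\<close>, the expected number of
  sinks is at least \<open>sqrt n\<close> and the events of being a sink are negatively correlated, so by
  Chebyshev a sink exists, and a sink is a Seymour vertex. If \<open>q \<ge> 1 / 4\<close>, any two vertices
  are joined by a directed path of length two, so every vertex with at most \<open>(n - 1) / 2\<close>
  out-neighbours is a Seymour vertex, and averaging out-degrees shows that one exists. In between,
  a single fixed vertex works: it has about \<open>(n - 1) q\<close> out-neighbours and,
  conditionally on these, the second neighbourhood is a sum of independent indicators
  whose mean exceeds their number by a constant factor.
\<close>

subsection \<open>Numerical estimates\<close>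

text \<open>Bernoulli's inequality bounds \<open>1 + q * s\<close> by \<open>(1 + q) ^ s\<close>,
  and \<open>(1 - q) * (1 + q)\<close> is at most 1. The rational bound on the probability that
  \<open>s\<close> possible arcs are all absent is easier to compare with \<open>s\<close> than an
  exponential one.\<close>

lemma one_minus_power_le:
  fixes q :: real
  assumes "0 \<le> q" "q \<le> 1"
  shows "(1 - q) ^ s \<le> 1 / (1 + q * s)"
proof -
  have "(1 - q) ^ s * (1 + q * s) \<le> (1 - q) ^ s * (1 + q) ^ s"
    using Bernoulli_inequality[of q s] assms by (intro mult_left_mono) (auto simp: mult.commute)
  also have "\<dots> = (1 - q\<^sup>2) ^ s"
    by (simp add: power2_eq_square algebra_simps flip: power_mult_distrib)
  also have "\<dots> \<le> 1" using assms by (intro power_le_one) (auto simp: power_le_one)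
  finally show ?thesis using assms by (simp add: pos_le_divide_eq add_pos_nonneg)
qed

text \<open>Here \<open>m\<close> counts the vertices other than a fixed one and \<open>s\<close>
  its out-neighbours. The right-hand side is then the expected number of second neighbours given
  those out-neighbours, and the factor 7/6 is the surplus that Chebyshev's inequality will
  consume.\<close>

lemma expected_second_neighbours_ge:
  fixes q m :: real and s :: nat
  assumes q: "0 \<le> q" "q \<le> 1 / 4" and mq: "4 \<le> m * q" and s: "s \<le> 6 / 5 * (m * q)"
  shows "7 / 6 * s \<le> (m - s) * (1 - (1 - q) ^ s)"
proof -
  define x where "x = q * s"
  have x: "0 \<le> x" using q by (simp add: x_def)
  have m: "0 < m" using q mq by (metis less_le_trans mult_eq_0_iff mult_nonpos_nonneg not_le zero_less_numeral)
  have "m * q \<le> m * (1 / 4)" using m q by (intro mult_left_mono) auto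
  with s have sm: "s \<le> 3 / 10 * m" by simp
  have "1 / (1 + x) \<ge> (1 - q) ^ s"
    unfolding x_def using q by (intro one_minus_power_le) auto
  then have r: "x / (1 + x) \<le> 1 - (1 - q) ^ s"
    using x by (simp add: field_simps)
  have "7 / 6 * s \<le> 7 / 10 * m * (x / (1 + x))"
  proof (cases "x \<le> 1")
    case True
    have "4 * real s \<le> m * q * s" using mq by (intro mult_right_mono) auto
    then have "7 / 6 * s \<le> 7 / 10 * m * (x / 2)" by (simp add: x_def field_simps)
    also have "\<dots> \<le> 7 / 10 * m * (x / (1 + x))"
      using True x m by (intro mult_left_mono divide_left_mono) auto
    finally show ?thesis .
  next
    case False
    \<comment> \<open>This case fixes the constant: 7/6 times 3/10 is exactly 7/20. The other case
      would allow 7/5.\<close>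
    have "7 / 6 * s \<le> 7 / 10 * m * (1 / 2)" using sm by simp
    also have "\<dots> \<le> 7 / 10 * m * (x / (1 + x))"
      using False m by (intro mult_left_mono) (auto simp: field_simps)
    finally show ?thesis .
  qed
  also have "\<dots> \<le> (m - s) * (1 - (1 - q) ^ s)"
    using sm r x m by (intro mult_mono) auto
  finally show ?thesis .
qed

text \<open>Up to \<open>q = 1 / 2\<close> one has \<open>1 - q \<ge> exp (- (2 * q))\<close>,
  because \<open>(1 - q) * (1 + 2 * q)\<close> is at least 1. The factor 2 lost in the exponent is
  why the sparse range stops at a quarter of the logarithm.\<close>

lemma exp_le_one_minus_power:
  fixes q :: real
  assumes "0 \<le> q" "q \<le> 1 / 2"
  shows "exp (- (2 * (m * q))) \<le> (1 - q) ^ m"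
proof -
  have "0 \<le> q * (1 - 2 * q)" using assms by simp
  then have "1 \<le> (1 - q) * (1 + 2 * q)" by (simp add: algebra_simps)
  also have "\<dots> \<le> (1 - q) * exp (2 * q)" using assms by (intro mult_left_mono) auto
  finally have "exp (- (2 * q)) \<le> 1 - q" by (simp add: exp_minus field_simps)
  then have "exp (- (2 * q)) ^ m \<le> (1 - q) ^ m" by (intro power_mono) auto
  then show ?thesis by (simp flip: exp_of_nat_mult add: algebra_simps)
qed

lemma failure_bound_tendsto:
  "(\<lambda>n :: nat. 400 / ln n + 1 / sqrt n + (real n)\<^sup>2 * (15 / 16) ^ n * (256 / 225)) \<longlonglongrightarrow> 0"
proof -
  have ln: "filterlim (\<lambda>n :: nat. ln (real n)) at_top sequentially"
    by (rule filterlim_compose[OF ln_at_top filterlim_real_sequentially])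
  have sqrt: "filterlim (\<lambda>n :: nat. sqrt (real n)) at_top sequentially"
    by (rule filterlim_compose[OF sqrt_at_top filterlim_real_sequentially])
  have "(\<lambda>n. 400 / ln (real n)) \<longlonglongrightarrow> 0"
    by (rule real_tendsto_divide_at_top[OF tendsto_const ln])
  moreover have "(\<lambda>n. 1 / sqrt (real n)) \<longlonglongrightarrow> 0"
    by (rule real_tendsto_divide_at_top[OF tendsto_const sqrt])
  moreover have "(\<lambda>n :: nat. (real n)\<^sup>2 * (15 / 16) ^ n) \<longlonglongrightarrow> 0"
  proof -
    \<comment> \<open>Taking the square root of the base turns the quadratic factor into a linear
      one; squaring the limit recovers the term.\<close>
    have "(\<lambda>n. real n * sqrt (15 / 16) ^ n) \<longlonglongrightarrow> 0"
      by (rule powser_times_n_limit_0) simp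
    then have "(\<lambda>n. (real n * sqrt (15 / 16) ^ n)\<^sup>2) \<longlonglongrightarrow> 0\<^sup>2" by (rule tendsto_power)
    moreover have "(sqrt (15 / 16) ^ n)\<^sup>2 = (15 / 16) ^ n" for n
      by (simp add: power2_eq_square del: real_sqrt_divide flip: power_mult_distrib)
    ultimately show ?thesis by (simp add: power_mult_distrib)
  qed
  then have "(\<lambda>n :: nat. (real n)\<^sup>2 * (15 / 16) ^ n * (256 / 225)) \<longlonglongrightarrow> 0"
    by (rule tendsto_mult_left_zero)
  ultimately show ?thesis by (intro tendsto_add_zero)
qed

text \<open>With 16 here, a mean out-degree of at least \<open>ln n / 4\<close> is at least 4, as
  the intermediate range demands.\<close>

lemma eventually_16_le_ln: "\<forall>\<^sub>F n :: nat in sequentially. 16 \<le> ln (real n)"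
  using filterlim_compose[OF ln_at_top filterlim_real_sequentially]
  by (simp only: filterlim_at_top)

subsection \<open>Random orientations as product measures\<close>

text \<open>Presence and direction of one edge are drawn together, with \<open>None\<close> for an
  absent edge. The two-stage experiment thereby becomes a single product measure, in which events on
  disjoint sets of pairs are independent.\<close>

definition arc_pmf :: "real \<Rightarrow> 'a set \<Rightarrow> ('a \<times> 'a) option pmf" where
  "arc_pmf p e = bind_pmf (bernoulli_pmf p)
     (\<lambda>b. if b then map_pmf Some (pmf_of_set {(u, v). {u, v} = e}) else return_pmf None)"

text \<open>The test \<open>f {u, v} = Some (u, v)\<close> discards every value of \<open>f\<close>
  that is not an arc over its own edge, so any function yields at most one arc per pair.\<close>

definition arcs_digraph :: "'a set \<Rightarrow> ('a set \<Rightarrow> ('a \<times> 'a) option) \<Rightarrow> 'a pair_pre_digraph" where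
  "arcs_digraph V f =
     \<lparr>pverts = V, parcs = {(u, v). {u, v} \<in> complete_edges V \<and> f {u, v} = Some (u, v)}\<rparr>"

lemma finite_complete_edges: "finite V \<Longrightarrow> finite (complete_edges V)"
  by (auto simp: complete_edges_def intro: finite_subset[of _ "Pow V"])

lemma doubleton_in_complete_edges [simp]:
  "{u, v} \<in> complete_edges V \<longleftrightarrow> u \<in> V \<and> v \<in> V \<and> u \<noteq> v"
  by (auto simp: complete_edges_def card_insert_if)

lemma arcs_over_doubleton: "{(a, b). {a, b} = {u, v}} = {(u, v), (v, u)}"
  by (auto simp: doubleton_eq_iff)

text \<open>An orientation amounts to a choice of one arc over each edge. The choices are written
  with default \<open>None\<close> because a product of uniform distributions in
  \<open>Pi_pmf\<close> is uniform on a set of this shape.\<close>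

lemma orientations_eq_image:
  assumes E: "E \<subseteq> complete_edges V"
  shows "orientations V E =
    arcs_digraph V ` PiE_dflt E None (\<lambda>e. Some ` {(u, v). {u, v} = e})"
proof (intro equalityI subsetI)
  fix D assume D: "D \<in> orientations V E"
  define und :: "'a \<times> 'a \<Rightarrow> 'a set" where "und = (\<lambda>(u, v). {u, v})"
  from D have D: "pverts D = V" "bij_betw und (parcs D) E"
    by (auto simp: orientations_def und_def)
  define f where "f e = (if e \<in> E then Some (inv_into (parcs D) und e) else None)" for e
  have inv: "und (inv_into (parcs D) und e) = e" if "e \<in> E" for e
    using D(2) that by (simp add: bij_betw_inv_into_right)
  have "f \<in> PiE_dflt E None (\<lambda>e. Some ` {(u, v). {u, v} = e})"
  proof -
    have "Some a \<in> Some ` {(u, v). {u, v} = e} \<longleftrightarrow> und a = e" for a e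
      by (cases a) (auto simp: und_def)
    with inv show ?thesis by (simp add: PiE_dflt_def f_def)
  qed
  moreover have "(u, v) \<in> parcs D \<longleftrightarrow> {u, v} \<in> complete_edges V \<and> f {u, v} = Some (u, v)" for u v
  proof
    assume uv: "(u, v) \<in> parcs D"
    then have "{u, v} \<in> E" using D(2) by (auto simp: bij_betw_def und_def)
    moreover have "inv_into (parcs D) und {u, v} = (u, v)"
      using bij_betw_inv_into_left[OF D(2) uv] by (simp add: und_def)
    ultimately show "{u, v} \<in> complete_edges V \<and> f {u, v} = Some (u, v)"
      using E by (auto simp: f_def simp del: doubleton_in_complete_edges)
  next
    assume "{u, v} \<in> complete_edges V \<and> f {u, v} = Some (u, v)"
    then have "{u, v} \<in> E" "inv_into (parcs D) und {u, v} = (u, v)"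
      by (auto simp: f_def split: if_splits)
    then show "(u, v) \<in> parcs D"
      by (metis D(2) bij_betw_def inv_into_into)
  qed
  then have "D = arcs_digraph V f"
    using D(1) by (cases D) (auto simp: arcs_digraph_def)
  ultimately show "D \<in> arcs_digraph V ` PiE_dflt E None (\<lambda>e. Some ` {(u, v). {u, v} = e})"
    by blast
next
  fix D assume "D \<in> arcs_digraph V ` PiE_dflt E None (\<lambda>e. Some ` {(u, v). {u, v} = e})"
  then obtain f where f: "f \<in> PiE_dflt E None (\<lambda>e. Some ` {(u, v). {u, v} = e})"
    and D: "D = arcs_digraph V f" by blast
  have "bij_betw (\<lambda>(u, v). {u, v}) (parcs D) E"
  proof (rule bij_betwI'; clarify?)
    fix a b c d assume "(a, b) \<in> parcs D" "(c, d) \<in> parcs D"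
    then have "f {a, b} = Some (a, b)" "f {c, d} = Some (c, d)"
      by (auto simp: D arcs_digraph_def)
    then show "({a, b} = {c, d}) = ((a, b) = (c, d))" by (metis option.inject prod.inject)
  next
    fix a b assume "(a, b) \<in> parcs D"
    then have "f {a, b} = Some (a, b)" by (auto simp: D arcs_digraph_def)
    then show "{a, b} \<in> E" using f by (cases "{a, b} \<in> E") (auto simp: PiE_dflt_def)
  next
    fix e assume e: "e \<in> E"
    then obtain u v where "f e = Some (u, v)" "{u, v} = e"
      using f by (auto simp: PiE_dflt_def)
    with e E have "(u, v) \<in> parcs D"
      by (auto simp: D arcs_digraph_def simp del: doubleton_in_complete_edges)
    with \<open>{u, v} = e\<close> show "\<exists>a\<in>parcs D. e = (case a of (u, v) \<Rightarrow> {u, v})" by force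
  qed
  then show "D \<in> orientations V E" by (simp add: orientations_def D arcs_digraph_def)
qed

text \<open>The chosen arc over each edge can be read off from the digraph. Injectivity is what
  carries the uniform distribution on choices to the uniform one on orientations.\<close>

lemma inj_on_arcs_digraph:
  assumes E: "E \<subseteq> complete_edges V"
  shows "inj_on (arcs_digraph V) (PiE_dflt E None (\<lambda>e. Some ` {(u, v). {u, v} = e}))"
proof (rule inj_onI, rule ext)
  fix f g e
  assume f: "f \<in> PiE_dflt E None (\<lambda>e. Some ` {(u, v). {u, v} = e})"
    and g: "g \<in> PiE_dflt E None (\<lambda>e. Some ` {(u, v). {u, v} = e})"
    and eq: "arcs_digraph V f = arcs_digraph V g"
  show "f e = g e"
  proof (cases "e \<in> E")
    case True
    then obtain u v where uv: "f e = Some (u, v)" "{u, v} = e"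
      using f by (auto simp: PiE_dflt_def)
    from eq have "(u, v) \<in> parcs (arcs_digraph V f) \<longleftrightarrow> (u, v) \<in> parcs (arcs_digraph V g)"
      by simp
    then show ?thesis using uv True E
      by (auto simp: arcs_digraph_def simp del: doubleton_in_complete_edges)
  next
    case False then show ?thesis using f g by (auto simp: PiE_dflt_def)
  qed
qed

text \<open>Given the edge set, independent fair directions form a uniform choice function, hence a
  uniform orientation. It remains to average over the edge set.\<close>

lemma random_orientation_eq_Pi_pmf:
  "random_orientation n p =
     map_pmf (arcs_digraph {1..n}) (Pi_pmf (complete_edges {1..n}) None (arc_pmf p))"
proof -
  let ?V = "{1..n}" let ?A = "complete_edges ?V"
  let ?B = "\<lambda>e :: nat set. {(u, v). {u, v} = e}"
  have fin: "finite ?A" by (simp add: finite_complete_edges)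
  have B: "finite (?B e) \<and> ?B e \<noteq> {}" if e: "e \<in> ?A" for e
  proof -
    from e obtain u v where "e = {u, v}" by (auto simp: complete_edges_def card_2_iff)
    then show ?thesis by (simp add: arcs_over_doubleton)
  qed
  have orient: "map_pmf (arcs_digraph ?V) (Pi_pmf ?A None
      (\<lambda>e. if f e then map_pmf Some (pmf_of_set (?B e)) else return_pmf None)) =
      pmf_of_set (orientations ?V {e \<in> ?A. f e})" for f
  proof -
    let ?E = "{e \<in> ?A. f e}"
    \<comment> \<open>Pairs outside the sampled graph carry the constant \<open>None\<close>, which
      is the default, so the product restricts to the edges.\<close>
    have "Pi_pmf ?A None (\<lambda>e. if f e then map_pmf Some (pmf_of_set (?B e)) else return_pmf None) =
        Pi_pmf ?E None (\<lambda>e. map_pmf Some (pmf_of_set (?B e)))"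
      by (rule Pi_pmf_if_set[OF fin])
    also have "\<dots> = Pi_pmf ?E None (\<lambda>e. pmf_of_set (Some ` ?B e))"
      by (intro Pi_pmf_cong refl map_pmf_of_set_inj) (use B in auto)
    also have "\<dots> = pmf_of_set (PiE_dflt ?E None (\<lambda>e. Some ` ?B e))"
      by (rule Pi_pmf_of_set) (use fin B in \<open>auto simp del: case_prod_conv\<close>)
    finally have 1: "Pi_pmf ?A None
        (\<lambda>e. if f e then map_pmf Some (pmf_of_set (?B e)) else return_pmf None) =
        pmf_of_set (PiE_dflt ?E None (\<lambda>e. Some ` ?B e))" .
    have "finite (PiE_dflt ?E None (\<lambda>e. Some ` ?B e))"
      by (rule finite_PiE_dflt) (use fin B in auto)
    moreover have "PiE_dflt ?E None (\<lambda>e. Some ` ?B e) \<noteq> {}"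
      unfolding PiE_dflt_empty_iff using B by blast
    moreover have "inj_on (arcs_digraph ?V) (PiE_dflt ?E None (\<lambda>e. Some ` ?B e))"
      by (rule inj_on_arcs_digraph) auto
    moreover have "orientations ?V ?E = arcs_digraph ?V ` PiE_dflt ?E None (\<lambda>e. Some ` ?B e)"
      by (rule orientations_eq_image) auto
    ultimately show ?thesis unfolding 1 by (metis (no_types, lifting) map_pmf_of_set_inj)
  qed
  \<comment> \<open>Drawing presence and direction edge by edge is the same as first drawing all
    presences and then all directions.\<close>
  have "map_pmf (arcs_digraph ?V) (Pi_pmf ?A None (arc_pmf p)) =
      bind_pmf (Pi_pmf ?A False (\<lambda>_. bernoulli_pmf p)) (\<lambda>f. map_pmf (arcs_digraph ?V)
        (Pi_pmf ?A None
          (\<lambda>e. if f e then map_pmf Some (pmf_of_set (?B e)) else return_pmf None)))"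
    unfolding arc_pmf_def by (subst Pi_pmf_bind[OF fin, of _ _ _ False]) (simp add: map_bind_pmf)
  also have "\<dots> = random_orientation n p"
    unfolding orient random_orientation_def gnp_def by (simp add: bind_map_pmf)
  finally show ?thesis ..
qed

section \<open>First and second neighbourhoods in terms of arcs\<close>

lemma nth_neighborhood_1:
  assumes "\<And>u v. (u, v) \<in> parcs D \<Longrightarrow> u \<in> pverts D \<and> v \<in> pverts D \<and> u \<noteq> v"
  shows "nth_neighborhood D 1 u = {v. (u, v) \<in> parcs D}"
proof -
  interpret pair_loopfree_digraph D by unfold_locales (use assms in auto)
  have "apath u xs v \<and> length xs = 1 \<longleftrightarrow> xs = [(u, v)] \<and> (u, v) \<in> parcs D" for xs v
    using assms by (cases xs) (auto simp: apath_simps length_Suc_conv)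
  moreover have "apath u xs v \<Longrightarrow> (u, v) \<in> parcs D \<Longrightarrow> 1 \<le> length xs" for xs v
    using assms by (cases xs) (auto simp: apath_simps)
  ultimately show ?thesis unfolding nth_neighborhood_def by auto metis+
qed

text \<open>Minimality of a two-arc path rules out the empty path and a single arc, that is,
  \<open>v = u\<close> and \<open>v\<close> an out-neighbour of \<open>u\<close>.\<close>

lemma nth_neighborhood_2:
  assumes "\<And>u v. (u, v) \<in> parcs D \<Longrightarrow> u \<in> pverts D \<and> v \<in> pverts D \<and> u \<noteq> v"
  shows "nth_neighborhood D 2 u =
    {v. v \<noteq> u \<and> (u, v) \<notin> parcs D \<and> (\<exists>w. (u, w) \<in> parcs D \<and> (w, v) \<in> parcs D)}"
proof -
  interpret pair_loopfree_digraph D by unfold_locales (use assms in auto)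
  have 0: "apath u [] v \<longleftrightarrow> u = v \<and> u \<in> pverts D" for v by (auto simp: apath_simps)
  have 1: "apath u [a] v \<longleftrightarrow> a = (u, v) \<and> (u, v) \<in> parcs D" for a v
    using assms by (cases a) (auto simp: apath_simps)
  \<comment> \<open>The vertices of an \<open>apath\<close> are distinct, which is where
    \<open>u \<noteq> v\<close> comes from.\<close>
  have 2: "apath u [a, b] v \<longleftrightarrow> (\<exists>w. a = (u, w) \<and> b = (w, v) \<and> u \<noteq> v \<and>
      (u, w) \<in> parcs D \<and> (w, v) \<in> parcs D)" for a b v
    using assms by (cases a; cases b) (auto simp: apath_simps)
  show ?thesis
  proof (intro equalityI subsetI)
    fix v assume "v \<in> nth_neighborhood D 2 u"
    then obtain xs where xs: "apath u xs v" "length xs = 2"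
      and min: "\<And>ys. apath u ys v \<Longrightarrow> 2 \<le> length ys"
      by (auto simp: nth_neighborhood_def)
    then obtain a b where "xs = [a, b]" by (auto simp: length_Suc_conv numeral_2_eq_2)
    with xs(1) 2[of a b v] min[of "[(u, v)]"] 1[of "(u, v)" v]
    show "v \<in> {v. v \<noteq> u \<and> (u, v) \<notin> parcs D \<and> (\<exists>w. (u, w) \<in> parcs D \<and> (w, v) \<in> parcs D)}"
      by auto
  next
    fix v
    assume "v \<in> {v. v \<noteq> u \<and> (u, v) \<notin> parcs D \<and> (\<exists>w. (u, w) \<in> parcs D \<and> (w, v) \<in> parcs D)}"
    then obtain w where w: "v \<noteq> u" "(u, v) \<notin> parcs D" "(u, w) \<in> parcs D" "(w, v) \<in> parcs D"
      by auto
    then have "apath u [(u, w), (w, v)] v" by (simp add: 2)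
    moreover have "length [(u, w), (w, v)] \<le> length ys" if "apath u ys v" for ys
    proof (rule ccontr)
      assume "\<not> length [(u, w), (w, v)] \<le> length ys"
      then consider "ys = []" | a where "ys = [a]" by (cases ys; cases "tl ys") auto
      then show False using that w by cases (auto simp: 0 1)
    qed
    ultimately show "v \<in> nth_neighborhood D 2 u"
      unfolding nth_neighborhood_def by (intro CollectI exI[of _ "[(u, w), (w, v)]"]) auto
  qed
qed

subsection \<open>Second moments and independence\<close>

lemma prob_card_deviation_le:
  fixes M :: "'a pmf" and E :: "'i \<Rightarrow> 'a set"
  assumes "finite I" "a > 0"
    and neg: "\<And>i j. i \<in> I \<Longrightarrow> j \<in> I \<Longrightarrow> i \<noteq> j \<Longrightarrow>
      measure_pmf.prob M (E i \<inter> E j) \<le> measure_pmf.prob M (E i) * measure_pmf.prob M (E j)"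
  defines "\<mu> \<equiv> \<Sum>i\<in>I. measure_pmf.prob M (E i)"
  shows "measure_pmf.prob M {x. a \<le> \<bar>real (card {i \<in> I. x \<in> E i}) - \<mu>\<bar>} \<le> \<mu> / a\<^sup>2"
proof -
  define f where "f x = real (card {i \<in> I. x \<in> E i})" for x
  have f_sum: "f x = (\<Sum>i\<in>I. indicator (E i) x)" for x
    using \<open>finite I\<close> by (simp add: f_def indicator_def sum.If_cases Int_def)
  have f_sq: "(f x)\<^sup>2 = (\<Sum>i\<in>I. \<Sum>j\<in>I. indicator (E i \<inter> E j) x)" for x
    by (simp add: f_sum power2_eq_square sum_product indicator_inter_arith)
  have int: "integrable M (\<lambda>x. indicator S x :: real)" for S
    by (rule measure_pmf.integrable_const_bound[of _ 1]) auto
  have Ef: "measure_pmf.expectation M f = \<mu>"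
    unfolding f_sum \<mu>_def using int by (subst Bochner_Integration.integral_sum) auto
  have Ef2: "measure_pmf.expectation M (\<lambda>x. (f x)\<^sup>2) =
      (\<Sum>i\<in>I. \<Sum>j\<in>I. measure_pmf.prob M (E i \<inter> E j))"
    unfolding f_sq using int
    by (subst Bochner_Integration.integral_sum, force, subst Bochner_Integration.integral_sum) auto
  have intf: "integrable M f" unfolding f_sum using int by auto
  have intf2: "integrable M (\<lambda>x. (f x)\<^sup>2)" unfolding f_sq using int by auto
  have "measure_pmf.variance M f =
      (\<Sum>i\<in>I. \<Sum>j\<in>I. measure_pmf.prob M (E i \<inter> E j)) - \<mu>\<^sup>2"
    using measure_pmf.variance_eq[OF intf intf2] by (simp add: Ef Ef2)
  also have "\<mu>\<^sup>2 = (\<Sum>i\<in>I. \<Sum>j\<in>I. measure_pmf.prob M (E i) * measure_pmf.prob M (E j))"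
    by (simp add: \<mu>_def power2_eq_square sum_product)
  also have "(\<Sum>i\<in>I. \<Sum>j\<in>I. measure_pmf.prob M (E i \<inter> E j)) - \<dots> =
      (\<Sum>i\<in>I. \<Sum>j\<in>I. measure_pmf.prob M (E i \<inter> E j) -
        measure_pmf.prob M (E i) * measure_pmf.prob M (E j))"
    by (simp add: sum_subtractf)
  \<comment> \<open>Off the diagonal the terms are covariances, which are at most 0 by
    \<open>neg\<close>; on it they have the form \<open>x - x\<^sup>2\<close> with \<open>x\<close>
    a probability.\<close>
  also have "\<dots> \<le> (\<Sum>i\<in>I. \<Sum>j\<in>I. if i = j then measure_pmf.prob M (E i) else 0)"
    using neg by (intro sum_mono) auto
  also have "\<dots> = \<mu>" using \<open>finite I\<close> by (simp add: \<mu>_def)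
  finally have var: "measure_pmf.variance M f \<le> \<mu>" .
  have "measure_pmf.prob M {x \<in> space M. a \<le> \<bar>f x - measure_pmf.expectation M f\<bar>} \<le>
      measure_pmf.variance M f / a\<^sup>2"
    using intf2 \<open>a > 0\<close> by (intro measure_pmf.Chebyshev_inequality) auto
  also have "\<dots> \<le> \<mu> / a\<^sup>2" using var by (simp add: divide_right_mono)
  finally show ?thesis by (simp add: Ef) (simp add: f_def)
qed

text \<open>This says that the event reads only the coordinates in \<open>J\<close>. Independence
  can then be checked by comparing index sets.\<close>

definition determined_by :: "'i set \<Rightarrow> ('i \<Rightarrow> 'b) set \<Rightarrow> bool" where
  "determined_by J E \<longleftrightarrow> (\<forall>f g. (\<forall>x\<in>J. f x = g x) \<longrightarrow> (f \<in> E \<longleftrightarrow> g \<in> E))"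

lemma determined_byI:
  assumes "\<And>f g. (\<And>x. x \<in> J \<Longrightarrow> f x = g x) \<Longrightarrow> f \<in> E \<Longrightarrow> g \<in> E"
  shows "determined_by J E"
  unfolding determined_by_def using assms by (metis (full_types))

lemma determined_byD:
  "determined_by J E \<Longrightarrow> (\<And>x. x \<in> J \<Longrightarrow> f x = g x) \<Longrightarrow> f \<in> E \<longleftrightarrow> g \<in> E"
  unfolding determined_by_def by blast

lemma determined_by_UNIV: "determined_by J UNIV"
  by (simp add: determined_by_def)

lemma determined_by_mono: "determined_by J E \<Longrightarrow> J \<subseteq> K \<Longrightarrow> determined_by K E"
  unfolding determined_by_def by blast

lemma determined_by_Compl: "determined_by J E \<Longrightarrow> determined_by J (- E)"
  unfolding determined_by_def by blast

lemma determined_by_Int: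
  "determined_by J E \<Longrightarrow> determined_by J F \<Longrightarrow> determined_by J (E \<inter> F)"
  unfolding determined_by_def by blast

lemma determined_by_INT:
  "(\<And>i. i \<in> I \<Longrightarrow> determined_by J (E i)) \<Longrightarrow> determined_by J (\<Inter>i\<in>I. E i)"
  unfolding determined_by_def by blast

lemma prob_pair_pmf_Times:
  "measure_pmf.prob (pair_pmf M N) (A \<times> B) = measure_pmf.prob M A * measure_pmf.prob N B"
proof -
  \<comment> \<open>Intersecting with the supports makes both factors countable, as the product rule
    requires, and changes no probability.\<close>
  have "measure_pmf.prob (pair_pmf M N) (A \<times> B) =
      measure_pmf.prob (pair_pmf M N) ((A \<inter> set_pmf M) \<times> (B \<inter> set_pmf N))"
    by (subst (1 2) measure_Int_set_pmf[symmetric]) (auto intro!: arg_cong[where f = "measure _"])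
  then show ?thesis
    by (simp add: measure_pmf_prob_product measure_Int_set_pmf)
qed

text \<open>The product over \<open>A\<close> is the merge of two independent products, over
  \<open>A \<inter> J\<close> and over \<open>A - J\<close>; each event sees only one of
  them.\<close>

lemma prob_Pi_pmf_Int:
  assumes A: "finite A" and E: "determined_by J E" and F: "determined_by K F" and JK: "J \<inter> K = {}"
  shows "measure_pmf.prob (Pi_pmf A d P) (E \<inter> F) =
    measure_pmf.prob (Pi_pmf A d P) E * measure_pmf.prob (Pi_pmf A d P) F"
proof -
  define X Y where "X = Pi_pmf (A \<inter> J) d P" and "Y = Pi_pmf (A - J) d P"
  define m where "m = (\<lambda>(f, g) x. if x \<in> A \<inter> J then f x else g x :: 'b)"
  have "Pi_pmf A d P = map_pmf m (pair_pmf X Y)"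
    using Pi_pmf_union[of "A \<inter> J" "A - J" d P] A
    by (simp add: X_def Y_def m_def Int_Diff_Un Int_Diff_disjoint)
  then have "measure_pmf.prob (Pi_pmf A d P) S = measure_pmf.prob (pair_pmf X Y) (m -` S)" for S
    by simp
  moreover have "measure_pmf.prob (pair_pmf X Y) (m -` (E' \<inter> F')) =
      measure_pmf.prob X E' * measure_pmf.prob Y F'"
    if E': "determined_by J E'" and F': "determined_by K F'" for E' F'
  proof -
    \<comment> \<open>\<open>J\<close> and \<open>K\<close> may reach outside \<open>A\<close>.
      There samples take the default \<open>d\<close> in either half, so the merge still agrees with
      \<open>f\<close> on \<open>J\<close> and with \<open>g\<close> on \<open>K\<close>.\<close>
    have "m (f, g) \<in> E' \<inter> F' \<longleftrightarrow> f \<in> E' \<and> g \<in> F'" if "f \<in> set_pmf X" "g \<in> set_pmf Y" for f g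
    proof -
      have "f x = d" if "x \<notin> A \<inter> J" for x
        using \<open>f \<in> set_pmf X\<close> that A unfolding X_def by (auto simp: set_Pi_pmf PiE_dflt_def)
      moreover have "g x = d" if "x \<notin> A - J" for x
        using \<open>g \<in> set_pmf Y\<close> that A unfolding Y_def by (auto simp: set_Pi_pmf PiE_dflt_def)
      ultimately have "m (f, g) x = f x" if "x \<in> J" for x
        using that by (auto simp: m_def)
      moreover have "m (f, g) x = g x" if "x \<in> K" for x
        using that JK by (auto simp: m_def)
      ultimately show ?thesis
        using determined_byD[OF E', of "m (f, g)" f] determined_byD[OF F', of "m (f, g)" g] by blast
    qed
    then have "m -` (E' \<inter> F') \<inter> set_pmf (pair_pmf X Y) = (E' \<times> F') \<inter> set_pmf (pair_pmf X Y)"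
      by auto
    then show ?thesis by (metis measure_Int_set_pmf prob_pair_pmf_Times)
  qed
  \<comment> \<open>Replacing one event by \<open>UNIV\<close> identifies the two factors as the
    probabilities of \<open>E\<close> and \<open>F\<close> themselves.\<close>
  from this[OF E F] this[OF E determined_by_UNIV] this[OF determined_by_UNIV F]
  have "measure_pmf.prob (pair_pmf X Y) (m -` (E \<inter> F)) =
    measure_pmf.prob (pair_pmf X Y) (m -` E) * measure_pmf.prob (pair_pmf X Y) (m -` F)"
    by simp
  ultimately show ?thesis by simp
qed

lemma prob_Pi_pmf_INT:
  assumes A: "finite A" and "finite I" and "\<And>i. i \<in> I \<Longrightarrow> determined_by (J i) (E i)"
    and "disjoint_family_on J I"
  shows "measure_pmf.prob (Pi_pmf A d P) (\<Inter>i\<in>I. E i) =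
    (\<Prod>i\<in>I. measure_pmf.prob (Pi_pmf A d P) (E i))"
  using assms(2-)
proof (induction I rule: finite_induct)
  case empty
  then show ?case by simp
next
  case (insert i I)
  have "determined_by (\<Union>i\<in>I. J i) (\<Inter>i\<in>I. E i)"
    by (intro determined_by_INT determined_by_mono[OF insert.prems(1)]) auto
  moreover have "J i \<inter> (\<Union>i\<in>I. J i) = {}"
    using insert by (auto simp: disjoint_family_on_def)
  ultimately have "measure_pmf.prob (Pi_pmf A d P) (E i \<inter> (\<Inter>i\<in>I. E i)) =
      measure_pmf.prob (Pi_pmf A d P) (E i) * measure_pmf.prob (Pi_pmf A d P) (\<Inter>i\<in>I. E i)"
    using A insert.prems(1) by (intro prob_Pi_pmf_Int) auto
  then show ?case
    using insert by (simp add: disjoint_family_on_mono[of I "insert i I"] subset_insertI)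
qed

subsection \<open>Sparse and dense digraphs\<close>

locale random_arcs =
  fixes V :: "'a set" and q :: real
  assumes finite_V: "finite V" and q_nonneg: "0 \<le> q" and q_le: "q \<le> 1 / 2"
begin

definition M :: "('a set \<Rightarrow> ('a \<times> 'a) option) pmf" where
  "M = Pi_pmf (complete_edges V) None (arc_pmf (2 * q))"

abbreviation prob where "prob \<equiv> measure_pmf.prob M"

definition has_arc :: "'a \<Rightarrow> 'a \<Rightarrow> ('a set \<Rightarrow> ('a \<times> 'a) option) set" where
  "has_arc u v = {f. u \<in> V \<and> v \<in> V \<and> u \<noteq> v \<and> f {u, v} = Some (u, v)}"

lemmas Int_prob =
  prob_Pi_pmf_Int[OF finite_complete_edges[OF finite_V],
    where d = None and P = "arc_pmf (2 * q)", folded M_def]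
lemmas INT_prob =
  prob_Pi_pmf_INT[OF finite_complete_edges[OF finite_V],
    where d = None and P = "arc_pmf (2 * q)", folded M_def]

lemma determined_has_arc: "determined_by {{u, v}} (has_arc u v)"
  by (rule determined_byI) (auto simp: has_arc_def)

lemma determined_has_arc': "determined_by {{u, v}} (has_arc v u)"
  by (rule determined_byI) (auto simp: has_arc_def insert_commute)

text \<open>The pair is an edge with probability \<open>2 * q\<close>, and each direction then has
  probability 1/2.\<close>

lemma prob_has_arc:
  assumes "u \<in> V" "v \<in> V" "u \<noteq> v"
  shows "prob (has_arc u v) = q"
proof -
  have "prob (has_arc u v) = measure_pmf.prob (map_pmf (\<lambda>f. f {u, v}) M) {Some (u, v)}"
    using assms by (simp add: has_arc_def vimage_def)
  also have "map_pmf (\<lambda>f. f {u, v}) M = arc_pmf (2 * q) {u, v}"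
    using assms unfolding M_def
    by (subst Pi_pmf_component) (auto simp: finite_complete_edges finite_V)
  also have "measure_pmf.prob \<dots> {Some (u, v)} = pmf (arc_pmf (2 * q) {u, v}) (Some (u, v))"
    by (simp add: measure_pmf_single)
  also have "\<dots> = q"
  proof -
    have "pmf (map_pmf Some (pmf_of_set {(u, v), (v, u)})) (Some (u, v)) = 1 / 2"
      using assms by (subst pmf_map_inj') auto
    then show ?thesis
      using q_nonneg q_le by (simp add: arc_pmf_def pmf_bind arcs_over_doubleton)
  qed
  finally show ?thesis .
qed

lemma prob_Compl: "prob (- S) = 1 - prob S"
  using measure_pmf.prob_compl[of S M] by (simp add: Compl_eq_Diff_UNIV)

text \<open>Arcs between \<open>u\<close> and different vertices lie over different pairs, so they
  are independent in either direction. The first part gives the probability of a sink, the second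
  that of being missed by all arcs from \<open>S\<close>.\<close>

lemma prob_no_arcs:
  assumes S: "S \<subseteq> V - {u}" and u: "u \<in> V"
  shows "prob (\<Inter>v\<in>S. - has_arc u v) = (1 - q) ^ card S"
    and "prob (\<Inter>v\<in>S. - has_arc v u) = (1 - q) ^ card S"
proof -
  have fin: "finite S" using S finite_V finite_subset by blast
  have dis: "disjoint_family_on (\<lambda>v. {{u, v}}) S"
    by (auto simp: disjoint_family_on_def doubleton_eq_iff)
  have "prob (\<Inter>v\<in>S. - has_arc u v) = (\<Prod>v\<in>S. prob (- has_arc u v))"
    using fin dis by (intro INT_prob) (auto intro: determined_by_Compl determined_has_arc)
  also have "\<dots> = (\<Prod>v\<in>S. 1 - q)"
    using S u by (intro prod.cong refl) (subst prob_Compl, subst prob_has_arc, auto)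
  finally show "prob (\<Inter>v\<in>S. - has_arc u v) = (1 - q) ^ card S" by simp
  have "prob (\<Inter>v\<in>S. - has_arc v u) = (\<Prod>v\<in>S. prob (- has_arc v u))"
    using fin dis by (intro INT_prob) (auto intro: determined_by_Compl determined_has_arc')
  also have "\<dots> = (\<Prod>v\<in>S. 1 - q)"
    using S u by (intro prod.cong refl) (subst prob_Compl, subst prob_has_arc, auto)
  finally show "prob (\<Inter>v\<in>S. - has_arc v u) = (1 - q) ^ card S" by simp
qed

definition out :: "('a set \<Rightarrow> ('a \<times> 'a) option) \<Rightarrow> 'a \<Rightarrow> 'a set" where
  "out f u = {v. f \<in> has_arc u v}"

definition out2 :: "('a set \<Rightarrow> ('a \<times> 'a) option) \<Rightarrow> 'a \<Rightarrow> 'a set" where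
  "out2 f u = {v \<in> V - {u} - out f u. \<exists>w\<in>out f u. f \<in> has_arc w v}"

lemma seymour_vertex_iff:
  "seymour_vertex (arcs_digraph V f) u \<longleftrightarrow> u \<in> V \<and> card (out f u) \<le> card (out2 f u)"
proof -
  let ?D = "arcs_digraph V f"
  have arcs: "(x, y) \<in> parcs ?D \<longleftrightarrow> f \<in> has_arc x y" for x y
    by (auto simp: arcs_digraph_def has_arc_def)
  have wf: "x \<in> pverts ?D \<and> y \<in> pverts ?D \<and> x \<noteq> y" if "(x, y) \<in> parcs ?D" for x y
    using that by (auto simp: arcs_digraph_def)
  have "nth_neighborhood ?D 1 u = out f u"
    using nth_neighborhood_1[OF wf] by (simp add: arcs out_def)
  moreover have "nth_neighborhood ?D 2 u = out2 f u"
    using nth_neighborhood_2[OF wf] by (auto simp: arcs out_def out2_def has_arc_def)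
  ultimately show ?thesis by (simp add: seymour_vertex_def arcs_digraph_def)
qed

definition bad :: "('a set \<Rightarrow> ('a \<times> 'a) option) set" where
  "bad = {f. \<forall>u\<in>V. card (out2 f u) < card (out f u)}"

lemma vimage_seymour_vertex: "arcs_digraph V -` {D. \<exists>u. seymour_vertex D u} = - bad"
  by (fastforce simp: seymour_vertex_iff bad_def not_less)

lemma out_subset: "out f u \<subseteq> V - {u}"
  by (auto simp: out_def has_arc_def)

lemma finite_out: "finite (out f u)"
  using out_subset finite_V by (meson finite_Diff finite_subset)

text \<open>The denominator is the expected number of sinks. A sink has two empty neighbourhoods and
  so is a Seymour vertex; hence in a bad digraph the number of sinks is 0, at distance the full mean
  from its expectation.\<close>

lemma prob_bad_le_sparse:
  assumes q1: "q < 1" and V: "V \<noteq> {}"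
  shows "prob bad \<le> 1 / (card V * (1 - q) ^ (card V - 1))"
proof -
  define S where "S u = (\<Inter>v\<in>V-{u}. - has_arc u v)" for u
  define \<mu> where "\<mu> = card V * (1 - q) ^ (card V - 1)"
  have PS: "prob (S u) = (1 - q) ^ (card V - 1)" if "u \<in> V" for u
    unfolding S_def using that finite_V by (subst prob_no_arcs) auto
  have neg: "prob (S u \<inter> S v) \<le> prob (S u) * prob (S v)" if uv: "u \<in> V" "v \<in> V" "u \<noteq> v" for u v
  proof -
    define W where "W = V - {u, v}"
    have cW: "card V - 1 = Suc (card W)"
    proof -
      have "card {u, v} \<le> card V" using uv finite_V by (intro card_mono) auto
      then show ?thesis using uv finite_V by (simp add: W_def card_Diff_subset)
    qed
    \<comment> \<open>The pair \<open>{u, v}\<close> is the only coordinate that both events read;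
      separating it leaves three independent events.\<close>
    have "S u \<inter> S v =
        ((\<Inter>w\<in>W. - has_arc u w) \<inter> (\<Inter>w\<in>W. - has_arc v w)) \<inter> (- (has_arc u v \<union> has_arc v u))"
      using uv by (auto simp: S_def W_def)
    also have "prob \<dots> =
        prob ((\<Inter>w\<in>W. - has_arc u w) \<inter> (\<Inter>w\<in>W. - has_arc v w)) * prob (- (has_arc u v \<union> has_arc v u))"
    proof (rule Int_prob)
      show "determined_by ((\<lambda>w. {u, w}) ` W \<union> (\<lambda>w. {v, w}) ` W)
          ((\<Inter>w\<in>W. - has_arc u w) \<inter> (\<Inter>w\<in>W. - has_arc v w))"
        by (intro determined_by_Int determined_by_INT determined_by_Compl)
           (auto intro: determined_by_mono[OF determined_has_arc])
      show "determined_by {{u, v}} (- (has_arc u v \<union> has_arc v u))"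
        by (simp add: determined_by_Int determined_by_Compl determined_has_arc determined_has_arc')
      show "((\<lambda>w. {u, w}) ` W \<union> (\<lambda>w. {v, w}) ` W) \<inter> {{u, v}} = {}"
        using uv by (auto simp: W_def doubleton_eq_iff)
    qed
    also have "prob ((\<Inter>w\<in>W. - has_arc u w) \<inter> (\<Inter>w\<in>W. - has_arc v w)) =
        prob (\<Inter>w\<in>W. - has_arc u w) * prob (\<Inter>w\<in>W. - has_arc v w)"
    proof (rule Int_prob)
      show "determined_by ((\<lambda>w. {u, w}) ` W) (\<Inter>w\<in>W. - has_arc u w)"
        by (intro determined_by_INT determined_by_Compl)
           (auto intro: determined_by_mono[OF determined_has_arc])
      show "determined_by ((\<lambda>w. {v, w}) ` W) (\<Inter>w\<in>W. - has_arc v w)"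
        by (intro determined_by_INT determined_by_Compl)
           (auto intro: determined_by_mono[OF determined_has_arc])
      show "(\<lambda>w. {u, w}) ` W \<inter> (\<lambda>w. {v, w}) ` W = {}"
        using uv by (auto simp: W_def doubleton_eq_iff)
    qed
    also have "prob (- (has_arc u v \<union> has_arc v u)) = 1 - 2 * q"
    proof -
      have "prob (has_arc u v \<union> has_arc v u) = prob (has_arc u v) + prob (has_arc v u)"
        by (intro measure_pmf.finite_measure_Union) (auto simp: has_arc_def insert_commute)
      then show ?thesis using uv by (subst prob_Compl) (simp add: prob_has_arc)
    qed
    also have "prob (\<Inter>w\<in>W. - has_arc u w) = (1 - q) ^ card W"
      using uv by (intro prob_no_arcs) (auto simp: W_def)
    also have "prob (\<Inter>w\<in>W. - has_arc v w) = (1 - q) ^ card W"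
      using uv by (intro prob_no_arcs) (auto simp: W_def)
    \<comment> \<open>Negative correlation arises here: the two arcs between \<open>u\<close> and
      \<open>v\<close> exclude each other, and
      \<open>1 - 2 * q \<le> (1 - q)\<^sup>2\<close>.\<close>
    also have "(1 - q) ^ card W * (1 - q) ^ card W * (1 - 2 * q) \<le>
        (1 - q) ^ card W * (1 - q) ^ card W * (1 - q)\<^sup>2"
      using q1 by (intro mult_left_mono) (auto simp: power2_eq_square algebra_simps)
    also have "\<dots> = prob (S u) * prob (S v)"
      using uv by (simp add: PS cW[unfolded One_nat_def] power2_eq_square)
    finally show ?thesis .
  qed
  have \<mu>: "(\<Sum>u\<in>V. prob (S u)) = \<mu>" by (simp add: PS \<mu>_def)
  have "\<mu> > 0" using q1 V finite_V by (simp add: \<mu>_def card_gt_0_iff)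
  have "bad \<subseteq> {f. \<mu> \<le> \<bar>real (card {u \<in> V. f \<in> S u}) - \<mu>\<bar>}"
  proof
    fix f assume f: "f \<in> bad"
    have "f \<notin> S u" if "u \<in> V" for u
    proof
      assume "f \<in> S u"
      then have "out f u = {}" by (auto simp: S_def out_def has_arc_def)
      with f that show False by (auto simp: bad_def)
    qed
    then have "{u \<in> V. f \<in> S u} = {}" by blast
    then show "f \<in> {f. \<mu> \<le> \<bar>real (card {u \<in> V. f \<in> S u}) - \<mu>\<bar>}"
      using \<open>\<mu> > 0\<close> by (simp only: card.empty mem_Collect_eq)
  qed
  then have "prob bad \<le> prob {f. \<mu> \<le> \<bar>real (card {u \<in> V. f \<in> S u}) - \<mu>\<bar>}"
    by (intro measure_pmf.finite_measure_mono) auto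
  also have "\<dots> \<le> \<mu> / \<mu>\<^sup>2"
    using prob_card_deviation_le[OF finite_V \<open>\<mu> > 0\<close>, of M S] neg by (simp add: \<mu>)
  also have "\<dots> = 1 / \<mu>" by (simp add: power2_eq_square)
  finally show ?thesis by (simp add: \<mu>_def)
qed

section \<open>Dense digraphs: paths of two arcs between all pairs\<close>

lemma prob_no_two_path:
  assumes uv: "u \<in> V" "v \<in> V" "u \<noteq> v"
  shows "prob (\<Inter>w\<in>V-{u,v}. - (has_arc u w \<inter> has_arc w v)) = (1 - q\<^sup>2) ^ (card V - 2)"
proof -
  let ?W = "V - {u, v}"
  have "prob (\<Inter>w\<in>?W. - (has_arc u w \<inter> has_arc w v)) = (\<Prod>w\<in>?W. prob (- (has_arc u w \<inter> has_arc w v)))"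
  proof (rule INT_prob)
    show "determined_by {{u, w}, {w, v}} (- (has_arc u w \<inter> has_arc w v))" for w
      by (intro determined_by_Compl determined_by_Int; rule determined_by_mono[OF determined_has_arc]) auto
    \<comment> \<open>Paths through different midpoints share no edge, hence are
      independent.\<close>
    show "disjoint_family_on (\<lambda>w. {{u, w}, {w, v}}) ?W"
      using uv by (auto simp: disjoint_family_on_def doubleton_eq_iff)
  qed (simp add: finite_V)
  also have "\<dots> = (\<Prod>w\<in>?W. 1 - q\<^sup>2)"
  proof (intro prod.cong refl)
    fix w assume w: "w \<in> ?W"
    have "prob (has_arc u w \<inter> has_arc w v) = prob (has_arc u w) * prob (has_arc w v)"
      using w uv by (intro Int_prob[OF determined_has_arc determined_has_arc]) (auto simp: doubleton_eq_iff)
    then show "prob (- (has_arc u w \<inter> has_arc w v)) = 1 - q\<^sup>2"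
      using w uv prob_has_arc[of u w] prob_has_arc[of w v] by (subst prob_Compl) (auto simp: power2_eq_square)
  qed
  also have "\<dots> = (1 - q\<^sup>2) ^ (card V - 2)"
    using uv finite_V by (simp add: card_Diff_subset numeral_2_eq_2)
  finally show ?thesis .
qed

text \<open>In-degrees and out-degrees have the same sum, and at each vertex they add up to at most
  \<open>card V - 1\<close>, since a pair carries at most one arc. The average out-degree is
  therefore at most half of that.\<close>

lemma exists_small_out:
  assumes V: "V \<noteq> {}"
  shows "\<exists>u\<in>V. 2 * card (out f u) \<le> card V - 1"
proof (rule ccontr)
  assume "\<not> ?thesis"
  then have large: "card V \<le> 2 * card (out f u)" if "u \<in> V" for u using that by force
  define inn where "inn u = {v \<in> V. f \<in> has_arc v u}" for u
  have "(\<Sum>u\<in>V. card (inn u)) = (\<Sum>u\<in>V. card {v \<in> V. f \<in> has_arc u v})"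
  proof -
    have "(\<Sum>u\<in>V. card (inn u)) = (\<Sum>u\<in>V. \<Sum>v\<in>V. if f \<in> has_arc v u then 1 else 0)"
      using finite_V by (simp add: inn_def sum.If_cases Int_def)
    also have "\<dots> = (\<Sum>v\<in>V. \<Sum>u\<in>V. if f \<in> has_arc v u then 1 else 0)" by (rule sum.swap)
    also have "\<dots> = (\<Sum>u\<in>V. card {v \<in> V. f \<in> has_arc u v})"
      using finite_V by (simp add: sum.If_cases Int_def)
    finally show ?thesis .
  qed
  also have "\<dots> = (\<Sum>u\<in>V. card (out f u))"
    by (intro sum.cong refl arg_cong[where f = card]) (auto simp: out_def has_arc_def)
  finally have in_out: "(\<Sum>u\<in>V. card (inn u)) = (\<Sum>u\<in>V. card (out f u))" .
  have "card V * card V \<le> (\<Sum>u\<in>V. 2 * card (out f u))"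
    using sum_mono[of V "\<lambda>_. card V", OF large] by simp
  also have "\<dots> = (\<Sum>u\<in>V. card (out f u) + card (inn u))"
    by (simp add: sum.distrib in_out flip: sum_distrib_left)
  also have "\<dots> \<le> (\<Sum>u\<in>V. card V - 1)"
  proof (rule sum_mono)
    fix u assume "u \<in> V"
    have "card (out f u) + card (inn u) = card (out f u \<union> inn u)"
      by (rule card_Un_disjoint[symmetric])
         (auto simp: finite_out finite_V inn_def out_def has_arc_def insert_commute)
    also have "\<dots> \<le> card (V - {u})"
      using finite_V by (intro card_mono) (auto simp: inn_def out_def has_arc_def)
    finally show "card (out f u) + card (inn u) \<le> card V - 1"
      using \<open>u \<in> V\<close> finite_V by simp
  qed
  also have "\<dots> = card V * (card V - 1)" by simp
  finally have "card V * card V \<le> card V * (card V - 1)" .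
  moreover have "card V > 0" using V finite_V by (simp add: card_gt_0_iff)
  ultimately show False by (subst (asm) mult_le_cancel1) linarith
qed

text \<open>A union bound over ordered pairs. If no pair lacks a two-arc path, every vertex other
  than \<open>u\<close> that is not an out-neighbour of \<open>u\<close> is a second neighbour, and
  a vertex of small out-degree has at least as many of these as out-neighbours.\<close>

lemma prob_bad_le_dense:
  assumes V: "V \<noteq> {}"
  shows "prob bad \<le> (card V)\<^sup>2 * (1 - q\<^sup>2) ^ (card V - 2)"
proof -
  define B where "B = (\<lambda>(u, v). \<Inter>w\<in>V-{u,v}. - (has_arc u w \<inter> has_arc w v))"
  define I where "I = {(u, v) \<in> V \<times> V. u \<noteq> v}"
  have I: "I \<subseteq> V \<times> V" "finite I"
    using finite_V by (auto simp: I_def intro: finite_subset[of _ "V \<times> V"])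
  have "bad \<subseteq> (\<Union>x\<in>I. B x)"
  proof
    fix f assume f: "f \<in> bad"
    obtain u where u: "u \<in> V" "2 * card (out f u) \<le> card V - 1"
      using exists_small_out[OF V] by blast
    show "f \<in> (\<Union>x\<in>I. B x)"
    proof (rule ccontr)
      assume no: "f \<notin> (\<Union>x\<in>I. B x)"
      have "V - {u} - out f u \<subseteq> out2 f u"
      proof
        fix v assume v: "v \<in> V - {u} - out f u"
        with u no have "f \<notin> B (u, v)" by (auto simp: I_def)
        then obtain w where "f \<in> has_arc u w" "f \<in> has_arc w v" by (auto simp: B_def)
        with v show "v \<in> out2 f u" by (auto simp: out2_def out_def)
      qed
      then have "card (V - {u} - out f u) \<le> card (out2 f u)"
        using finite_V by (intro card_mono) (auto simp: out2_def)
      moreover have "card (V - {u} - out f u) = card V - 1 - card (out f u)"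
        using u finite_V out_subset[of f u] by (simp add: card_Diff_subset finite_out)
      ultimately show False using f u by (force simp: bad_def)
    qed
  qed
  then have "prob bad \<le> prob (\<Union>x\<in>I. B x)"
    by (intro measure_pmf.finite_measure_mono) auto
  also have "\<dots> \<le> (\<Sum>x\<in>I. prob (B x))"
    using I by (intro measure_pmf.finite_measure_subadditive_finite) auto
  also have "\<dots> = (\<Sum>x\<in>I. (1 - q\<^sup>2) ^ (card V - 2))"
  proof (intro sum.cong refl)
    fix x assume "x \<in> I"
    then obtain u v where "x = (u, v)" "u \<in> V" "v \<in> V" "u \<noteq> v" by (auto simp: I_def)
    then show "prob (B x) = (1 - q\<^sup>2) ^ (card V - 2)"
      by (simp only: B_def prod.case) (rule prob_no_two_path)
  qed
  also have "\<dots> = card I * (1 - q\<^sup>2) ^ (card V - 2)" by simp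
  also have "\<dots> \<le> (card V)\<^sup>2 * (1 - q\<^sup>2) ^ (card V - 2)"
  proof (rule mult_right_mono)
    have "card I \<le> card (V \<times> V)" using I finite_V by (intro card_mono) auto
    then show "real (card I) \<le> real ((card V)\<^sup>2)"
      by (simp add: card_cartesian_product power2_eq_square del: of_nat_mult)
    have "q\<^sup>2 \<le> 1" using q_nonneg q_le by (simp add: power_le_one_iff abs_square_le_1)
    then show "0 \<le> (1 - q\<^sup>2) ^ (card V - 2)" by simp
  qed
  finally show ?thesis .
qed

end

subsection \<open>The intermediate range\<close>

context random_arcs
begin

text \<open>\<open>S\<close> stands for a prescribed out-neighbourhood of \<open>u\<close> of nearly
  average size. The events that a vertex outside \<open>S\<close> is hit from \<open>S\<close> read
  disjoint sets of pairs, so they are independent and Chebyshev's inequality applies to their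
  count.\<close>

lemma prob_few_second_neighbours_le:
  defines "\<mu> \<equiv> real (card V - 1) * q"
  assumes u: "u \<in> V" and S: "S \<subseteq> V - {u}"
    and q4: "q \<le> 1 / 4" and mq: "4 \<le> \<mu>"
    and s: "4 / 5 * \<mu> \<le> card S" "card S \<le> 6 / 5 * \<mu>"
  shows "prob {f. card {v \<in> V - {u} - S. f \<in> (\<Union>w\<in>S. has_arc w v)} < card S} \<le>
    53 / \<mu>"
proof -
  define T where "T = V - {u} - S"
  define C where "C v = (\<Union>w\<in>S. has_arc w v)" for v
  define \<nu> where "\<nu> = (\<Sum>v\<in>T. prob (C v))"
  have fin: "finite S" "finite T" using S finite_V finite_subset by (auto simp: T_def)
  have PC: "prob (C v) = 1 - (1 - q) ^ card S" if "v \<in> T" for v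
  proof -
    have "prob (- C v) = (1 - q) ^ card S"
      using prob_no_arcs(2)[of S v] that S by (auto simp: C_def T_def)
    then show ?thesis by (simp add: prob_Compl)
  qed
  have "card T = card V - 1 - card S"
    using u S fin finite_V by (simp add: T_def card_Diff_subset)
  moreover have "card S \<le> card V - 1"
    using card_mono[OF _ S] u finite_V by simp
  ultimately have "real (card T) = real (card V - 1) - real (card S)"
    by (simp only: of_nat_diff)
  then have "\<nu> = (real (card V - 1) - real (card S)) * (1 - (1 - q) ^ card S)"
    by (simp add: \<nu>_def PC)
  moreover have "7 / 6 * card S \<le> (real (card V - 1) - real (card S)) * (1 - (1 - q) ^ card S)"
    using q_nonneg q4 mq[unfolded \<mu>_def] s(2)[unfolded \<mu>_def]
    by (rule expected_second_neighbours_ge)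
  ultimately have \<nu>: "7 / 6 * card S \<le> \<nu>" by (simp only:)
  \<comment> \<open>14/15 is the product of 7/6 and 4/5.\<close>
  with s mq have \<nu>_ge: "14 / 15 * \<mu> \<le> \<nu>" and "\<nu> > 0" by linarith+
  have det: "determined_by ((\<lambda>w. {w, v}) ` S) (C v)" for v
    unfolding C_def by (rule determined_byI) (auto simp: has_arc_def)
  have neg: "prob (C v \<inter> C v') \<le> prob (C v) * prob (C v')" if "v \<in> T" "v' \<in> T" "v \<noteq> v'" for v v'
    using that by (intro eq_refl Int_prob[OF det det]) (auto simp: T_def doubleton_eq_iff)
  \<comment> \<open>Since \<open>card S\<close> is at most 6/7 of \<open>\<nu>\<close>, a count
    below \<open>card S\<close> misses its mean by more than \<open>\<nu> / 7\<close>.\<close>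
  have "{f. card {v \<in> T. f \<in> C v} < card S} \<subseteq>
      {f. \<nu> / 7 \<le> \<bar>real (card {v \<in> T. f \<in> C v}) - \<nu>\<bar>}"
    using \<nu> by auto
  then have "prob {f. card {v \<in> T. f \<in> C v} < card S} \<le>
      prob {f. \<nu> / 7 \<le> \<bar>real (card {v \<in> T. f \<in> C v}) - \<nu>\<bar>}"
    by (intro measure_pmf.finite_measure_mono) auto
  also have "\<dots> \<le> \<nu> / (\<nu> / 7)\<^sup>2"
    using prob_card_deviation_le[OF fin(2), of "\<nu> / 7" M C] neg \<open>\<nu> > 0\<close> by (simp add: \<nu>_def)
  also have "\<dots> = 49 / \<nu>" using \<open>\<nu> > 0\<close> by (simp add: power2_eq_square)
  also have "\<dots> \<le> 49 / (14 / 15 * \<mu>)"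
    using \<nu>_ge mq \<open>\<nu> > 0\<close> by (intro divide_left_mono) auto
  also have "\<dots> \<le> 53 / \<mu>"
    using mq by (simp add: field_simps)
  finally show ?thesis by (simp add: T_def C_def)
qed

text \<open>One vertex \<open>u\<close> is examined. Either its out-degree is atypical, or its
  out-neighbourhood is some typical \<open>S\<close>; in the latter case the arcs leaving
  \<open>S\<close> towards vertices other than \<open>u\<close> are still unexposed and can be
  treated as fresh randomness.\<close>

lemma prob_bad_le_middle:
  assumes V: "V \<noteq> {}" and q4: "q \<le> 1 / 4" and mq: "4 \<le> real (card V - 1) * q"
  shows "prob bad \<le> 100 / (real (card V - 1) * q)"
proof -
  obtain u where u: "u \<in> V" using V by blast
  define \<mu> where "\<mu> = real (card V - 1) * q"
  \<comment> \<open>The tolerance 1/5 matches the bounds 4/5 and 6/5 on the size of a typical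
    out-neighbourhood.\<close>
  define dev where "dev = {f. \<mu> / 5 \<le> \<bar>real (card {v \<in> V - {u}. f \<in> has_arc u v}) - \<mu>\<bar>}"
  define G where "G = {S. S \<subseteq> V - {u} \<and> \<bar>real (card S) - \<mu>\<bar> < \<mu> / 5}"
  define Z where "Z S = {f. out f u = S}" for S
  define W where "W S = {f. card {v \<in> V - {u} - S. f \<in> (\<Union>w\<in>S. has_arc w v)} < card S}" for S
  have "4 \<le> \<mu>" using mq by (simp only: \<mu>_def)
  then have "\<mu> > 0" by simp
  have finG: "finite G" using finite_V by (simp add: G_def)
  have "(\<Sum>v\<in>V-{u}. prob (has_arc u v)) = (\<Sum>v\<in>V-{u}. q)"
    using u by (intro sum.cong) (auto simp: prob_has_arc)
  then have \<mu>_sum: "(\<Sum>v\<in>V-{u}. prob (has_arc u v)) = \<mu>"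
    using u finite_V by (simp add: \<mu>_def)
  have dev: "prob dev \<le> 25 / \<mu>"
  proof -
    have neg: "prob (has_arc u v \<inter> has_arc u w) \<le> prob (has_arc u v) * prob (has_arc u w)"
      if "v \<in> V - {u}" "w \<in> V - {u}" "v \<noteq> w" for v w
      using that by (intro eq_refl Int_prob[OF determined_has_arc determined_has_arc])
        (auto simp: doubleton_eq_iff)
    have "prob dev \<le> \<mu> / (\<mu> / 5)\<^sup>2"
      using prob_card_deviation_le[of "V - {u}" "\<mu> / 5" M "has_arc u"] neg finite_V \<open>\<mu> > 0\<close>
      by (simp add: dev_def \<mu>_sum)
    also have "\<dots> = 25 / \<mu>" using \<open>\<mu> > 0\<close> by (simp add: power2_eq_square)
    finally show ?thesis .
  qed
  have ZW: "prob (Z S \<inter> W S) \<le> prob (Z S) * (53 / \<mu>)" if S: "S \<in> G" for S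
  proof -
    have "prob (Z S \<inter> W S) = prob (Z S) * prob (W S)"
    proof (rule Int_prob)
      show "determined_by ((\<lambda>v. {u, v}) ` V) (Z S)"
      proof (rule determined_byI)
        fix f g :: "'a set \<Rightarrow> ('a \<times> 'a) option"
        assume "\<And>x. x \<in> (\<lambda>v. {u, v}) ` V \<Longrightarrow> f x = g x"
        then have "f {u, v} = g {u, v}" if "v \<in> V" for v
          using that by (meson imageI)
        then have "f \<in> has_arc u v \<longleftrightarrow> g \<in> has_arc u v" for v
          by (cases "v \<in> V") (simp_all add: has_arc_def)
        then have "out f u = out g u" by (simp only: out_def)
        then show "f \<in> Z S \<Longrightarrow> g \<in> Z S" by (simp only: Z_def mem_Collect_eq)
      qed
      show "determined_by {{w, v} |w v. w \<in> S \<and> v \<in> V - {u}} (W S)"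
      proof (rule determined_byI)
        fix f g :: "'a set \<Rightarrow> ('a \<times> 'a) option"
        assume "\<And>x. x \<in> {{w, v} |w v. w \<in> S \<and> v \<in> V - {u}} \<Longrightarrow> f x = g x"
        then have "f {w, v} = g {w, v}" if "w \<in> S" "v \<in> V - {u}" for v w
          using that by blast
        then have "f \<in> has_arc w v \<longleftrightarrow> g \<in> has_arc w v" if "w \<in> S" "v \<in> V - {u}" for v w
          using that by (simp add: has_arc_def)
        then have "{v \<in> V - {u} - S. f \<in> (\<Union>w\<in>S. has_arc w v)} =
            {v \<in> V - {u} - S. g \<in> (\<Union>w\<in>S. has_arc w v)}" by blast
        then show "f \<in> W S \<Longrightarrow> g \<in> W S" by (simp only: W_def mem_Collect_eq)
      qed
      \<comment> \<open>\<open>Z S\<close> reads only sets containing \<open>u\<close>, while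
        \<open>S\<close> avoids \<open>u\<close>, so no set read by \<open>W S\<close> contains
        it.\<close>
      show "(\<lambda>v. {u, v}) ` V \<inter> {{w, v} |w v. w \<in> S \<and> v \<in> V - {u}} = {}"
        using S by (auto simp: G_def doubleton_eq_iff)
    qed
    also have "prob (W S) \<le> 53 / \<mu>"
    proof -
      have "S \<subseteq> V - {u}" and S\<mu>: "\<bar>real (card S) - \<mu>\<bar> < \<mu> / 5"
        using S by (simp_all only: G_def mem_Collect_eq)
      moreover have "4 / 5 * \<mu> \<le> card S" "card S \<le> 6 / 5 * \<mu>"
        using S\<mu> by linarith+
      ultimately show ?thesis
        unfolding W_def using u q4 \<open>4 \<le> \<mu>\<close>
        by (intro prob_few_second_neighbours_le[folded \<mu>_def])
    qed
    finally show ?thesis by (simp add: mult_left_mono)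
  qed
  have "bad \<subseteq> dev \<union> (\<Union>S\<in>G. Z S \<inter> W S)"
  proof
    fix f assume f: "f \<in> bad"
    define S where "S = out f u"
    have S: "S \<subseteq> V - {u}" using out_subset by (auto simp: S_def)
    have "{v \<in> V - {u}. f \<in> has_arc u v} = S" using S by (auto simp: S_def out_def)
    moreover have "out2 f u = {v \<in> V - {u} - S. f \<in> (\<Union>w\<in>S. has_arc w v)}"
      by (auto simp: out2_def S_def)
    with f u have "f \<in> Z S \<inter> W S" by (auto simp: bad_def Z_def W_def S_def)
    ultimately show "f \<in> dev \<union> (\<Union>S\<in>G. Z S \<inter> W S)"
      using S by (cases "S \<in> G") (auto simp: dev_def G_def)
  qed
  then have "prob bad \<le> prob (dev \<union> (\<Union>S\<in>G. Z S \<inter> W S))"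
    by (intro measure_pmf.finite_measure_mono) auto
  also have "\<dots> \<le> prob dev + prob (\<Union>S\<in>G. Z S \<inter> W S)"
    by (intro measure_Un_le) auto
  also have "prob (\<Union>S\<in>G. Z S \<inter> W S) \<le> (\<Sum>S\<in>G. prob (Z S \<inter> W S))"
    using finG by (intro measure_pmf.finite_measure_subadditive_finite) auto
  also have "\<dots> \<le> (\<Sum>S\<in>G. prob (Z S)) * (53 / \<mu>)"
    unfolding sum_distrib_right by (intro sum_mono ZW)
  \<comment> \<open>The events \<open>Z S\<close> are disjoint, so summing over all typical
    \<open>S\<close> costs nothing however many there are.\<close>
  also have "(\<Sum>S\<in>G. prob (Z S)) = prob (\<Union>S\<in>G. Z S)"
    using finG by (intro measure_pmf.finite_measure_finite_Union[symmetric])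
      (auto simp: disjoint_family_on_def Z_def)
  also have "\<dots> * (53 / \<mu>) \<le> 1 * (53 / \<mu>)"
    using \<open>\<mu> > 0\<close> by (intro mult_right_mono) auto
  finally have "prob bad \<le> 25 / \<mu> + 53 / \<mu>" using dev by simp
  also have "\<dots> \<le> 100 / \<mu>" using \<open>\<mu> > 0\<close> by (simp add: field_simps)
  finally show ?thesis by (simp add: \<mu>_def)
qed

end

section \<open>Combining the three ranges of the arc probability\<close>

lemma (in random_arcs) prob_bad_le:
  assumes "16 \<le> ln (card V)" "q < 1 / 2"
  shows "prob bad \<le> 400 / ln (card V) + 1 / sqrt (card V) +
    (card V)\<^sup>2 * (15 / 16) ^ card V * (256 / 225)"
proof -
  define n where "n = card V"
  \<comment> \<open>The logarithm is 0 at 1 and, by convention, at 0.\<close>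
  have n: "2 \<le> n"
  proof (rule ccontr)
    assume "\<not> 2 \<le> n"
    then have "n = 0 \<or> n = 1" by auto
    then show False using assms by (auto simp: n_def)
  qed
  then have V: "V \<noteq> {}" by (auto simp: n_def)
  have pos: "0 \<le> 400 / ln n" "0 \<le> 1 / sqrt n" "0 \<le> n\<^sup>2 * (15 / 16 :: real) ^ n * (256 / 225)"
    using assms by (auto simp: n_def)
  consider "1 / 4 \<le> q" | "q \<le> 1 / 4" "ln n / 4 \<le> real (n - 1) * q" | "real (n - 1) * q \<le> ln n / 4"
    by linarith
  then have "prob bad \<le> 400 / ln n + 1 / sqrt n + n\<^sup>2 * (15 / 16) ^ n * (256 / 225)"
  proof cases
    case 1
    have "(1 / 4)\<^sup>2 \<le> q\<^sup>2" using 1 by (intro power_mono) auto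
    moreover have "q\<^sup>2 \<le> 1" using q_nonneg q_le by (simp add: abs_square_le_1)
    ultimately have "n\<^sup>2 * (1 - q\<^sup>2) ^ (n - 2) \<le> n\<^sup>2 * (15 / 16) ^ (n - 2)"
      by (intro mult_left_mono power_mono) (auto simp: power2_eq_square)
    \<comment> \<open>256/225 is the square of 16/15 and makes up for the two missing
      factors.\<close>
    also have "(15 / 16 :: real) ^ (n - 2) = (15 / 16) ^ n * (256 / 225)"
      using n by (simp add: power_diff power2_eq_square)
    finally show ?thesis using prob_bad_le_dense[OF V, folded n_def] pos by linarith
  next
    case 2
    have ln: "4 \<le> real (n - 1) * q" "0 < ln n / 4"
      using 2(2) assms(1) unfolding n_def by linarith+
    from ln(1) have "prob bad \<le> 100 / (real (n - 1) * q)"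
      unfolding n_def using 2(1) by (intro prob_bad_le_middle V)
    also have "\<dots> \<le> 100 / (ln n / 4)"
      using 2(2) ln by (intro divide_left_mono mult_pos_pos[of "real (n - 1) * q"]) auto
    also have "\<dots> = 400 / ln n" by simp
    finally show ?thesis using pos by linarith
  next
    case 3
    \<comment> \<open>Twice the threshold \<open>ln n / 4\<close> is the exponent that leaves at
      least \<open>sqrt n\<close> expected sinks.\<close>
    have "sqrt n = n * exp (- (ln n / 2))"
      using n by (simp add: exp_minus ln_sqrt[symmetric] field_simps)
    also have "\<dots> \<le> n * exp (- (2 * (real (n - 1) * q)))" using 3 by (intro mult_left_mono) auto
    also have "\<dots> \<le> n * (1 - q) ^ (n - 1)"
      using exp_le_one_minus_power[OF q_nonneg q_le] by (intro mult_left_mono) auto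
    finally have "1 / (n * (1 - q) ^ (n - 1)) \<le> 1 / sqrt n"
      using n assms by (intro divide_left_mono) auto
    then show ?thesis using prob_bad_le_sparse[OF _ V, folded n_def] assms(2) pos by linarith
  qed
  then show ?thesis by (simp add: n_def)
qed

text \<open>The bound depends on \<open>n\<close> alone, so it applies along any sequence of edge
  probabilities, including one that moves between the three ranges.\<close>

lemma prob_seymour_vertex_ge:
  assumes p: "0 < p" "p < 1" and n: "16 \<le> ln (real n)"
  shows "1 - (400 / ln n + 1 / sqrt n + (real n)\<^sup>2 * (15 / 16) ^ n * (256 / 225)) \<le>
    measure_pmf.prob (random_orientation n p) {D. \<exists>u. seymour_vertex D u}"
proof -
  interpret random_arcs "{1..n}" "p / 2"
    by unfold_locales (use p in auto)
  have M: "M = Pi_pmf (complete_edges {1..n}) None (arc_pmf p)" unfolding M_def by simp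
  have "measure_pmf.prob (random_orientation n p) {D. \<exists>u. seymour_vertex D u} = 1 - prob bad"
    unfolding random_orientation_eq_Pi_pmf measure_map_pmf vimage_seymour_vertex M[symmetric]
    by (rule prob_Compl)
  then show ?thesis using prob_bad_le n p by simp
qed

theorem theorem4:
  fixes p :: "nat \<Rightarrow> real"
  assumes "\<And>n. 0 < p n \<and> p n < 1"
  shows "(\<lambda>n. measure_pmf.prob (random_orientation n (p n))
            {D. \<exists>u. seymour_vertex D u}) \<longlonglongrightarrow> 1"
proof (rule tendsto_sandwich[where h = "\<lambda>_. 1"])
  show "(\<lambda>n. 1 - (400 / ln n + 1 / sqrt n + (real n)\<^sup>2 * (15 / 16) ^ n * (256 / 225))) \<longlonglongrightarrow> 1"
    using tendsto_diff[OF tendsto_const[of 1] failure_bound_tendsto] by simp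
  show "\<forall>\<^sub>F n in sequentially.
      1 - (400 / ln n + 1 / sqrt n + (real n)\<^sup>2 * (15 / 16) ^ n * (256 / 225)) \<le>
      measure_pmf.prob (random_orientation n (p n)) {D. \<exists>u. seymour_vertex D u}"
    using eventually_16_le_ln
  proof eventually_elim
    case (elim n)
    then show ?case using prob_seymour_vertex_ge[of "p n" n] assms[of n] by blast
  qed
qed (simp_all add: always_eventually)

end
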